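(* Let $f_3:\mathbb{C}_2\times\mathbb{C}_2\to\mathbb{C}_1$ be defined by $f_3(\xi,\eta)=\xi^-\,\overline{\eta^-}+\xi^+\,\overline{\eta^+}$, where $\xi^\pm,\eta^\pm\in\mathbb{C}_1$ are the idempotent components of $\xi,\eta$. Then: (a) $f_3(\xi,\xi)\ge 0$ for all $\xi\in\mathbb{C}_2$; (b) $f_3(\xi,\xi)=0$ if and only if $\xi=0$; (c) $\overline{f_3(\eta,\xi)}=f_3(\xi,\eta)$ for all $\xi,\eta\in\mathbb{C}_2$; (d) $f_3(\xi+\eta,\zeta)=f_3(\xi,\zeta)+f_3(\eta,\zeta)$ for all $\xi,\eta,\zeta\in\mathbb{C}_2$; (e) $f_3(\alpha\cdot\xi,\eta)=\alpha f_3(\xi,\eta)$ for all $\xi,\eta\in\mathbb{C}_2$ and all $\alpha\in\mathbb{C}_1$.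
   Context: $\mathbb{C}_0$ is the set of real numbers and $\mathbb{C}_1=\{a+i_1b: a,b\in\mathbb{C}_0\}$ the set of complex numbers, with complex conjugation written $\overline{\,\cdot\,}$. $\mathbb{C}_2$ is the set of bicomplex numbers $\xi=x_1+i_1x_2+i_2x_3+i_1i_2x_4$ with $x_1,\dots,x_4$ real, where $i_1^2=i_2^2=-1$ and $i_1i_2=i_2i_1$; it is a commutative algebra over $\mathbb{C}_1$ and over $\mathbb{C}_0$. Equivalently $\xi=z_1+i_2z_2$ with $z_1=x_1+i_1x_2$, $z_2=x_3+i_1x_4\in\mathbb{C}_1$. The idempotent components of $\xi$ are $\xi^-=z_1-i_1z_2$ and $\xi^+=z_1+i_1z_2$ in $\mathbb{C}_1$; with $e_1=(1+i_1i_2)/2$, $e_2=(1-i_1i_2)/2$ one has uniquely $\xi=\xi^-e_1+\xi^+e_2$. Addition is componentwise, and for $\alpha\in\mathbb{C}_1$, $\alpha\cdot\xi=\alpha z_1+i_2\,\alpha z_2$. For a complex-valued expression, "$\ge 0$" means that it is a nonnegative real number. *)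

theory Defs
  imports Complex_Main "HOL-Library.Nonpos_Ints"
begin

text \<open>
  A bicomplex number \<open>z\<^sub>1 + i\<^sub>2 z\<^sub>2\<close> is represented by its two complex coordinates. In terms of the
  real coordinates of \<open>x\<^sub>1 + i\<^sub>1 x\<^sub>2 + i\<^sub>2 x\<^sub>3 + i\<^sub>1 i\<^sub>2 x\<^sub>4\<close> it is
  \<open>Bicomplex (Complex x\<^sub>1 x\<^sub>2) (Complex x\<^sub>3 x\<^sub>4)\<close>.
\<close>

datatype bicomplex = Bicomplex (bc1: complex) (bc2: complex)

lemma bicomplex_eq_iff: "x = y \<longleftrightarrow> bc1 x = bc1 y \<and> bc2 x = bc2 y"
  by (cases x; cases y) simp

instantiation bicomplex :: "{comm_ring_1, real_algebra_1}"
begin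

definition zero_bicomplex :: bicomplex where "0 = Bicomplex 0 0"

definition one_bicomplex :: bicomplex where "1 = Bicomplex 1 0"

definition plus_bicomplex :: "bicomplex \<Rightarrow> bicomplex \<Rightarrow> bicomplex" where
  "x + y = Bicomplex (bc1 x + bc1 y) (bc2 x + bc2 y)"

definition uminus_bicomplex :: "bicomplex \<Rightarrow> bicomplex" where
  "- x = Bicomplex (- bc1 x) (- bc2 x)"

definition minus_bicomplex :: "bicomplex \<Rightarrow> bicomplex \<Rightarrow> bicomplex" where
  "x - y = Bicomplex (bc1 x - bc1 y) (bc2 x - bc2 y)"

definition times_bicomplex :: "bicomplex \<Rightarrow> bicomplex \<Rightarrow> bicomplex" where
  "x * y = Bicomplex (bc1 x * bc1 y - bc2 x * bc2 y) (bc1 x * bc2 y + bc2 x * bc1 y)"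

definition scaleR_bicomplex :: "real \<Rightarrow> bicomplex \<Rightarrow> bicomplex" where
  "r *\<^sub>R x = Bicomplex (r *\<^sub>R bc1 x) (r *\<^sub>R bc2 x)"

instance
  by standard
    (simp_all add: zero_bicomplex_def one_bicomplex_def plus_bicomplex_def uminus_bicomplex_def
      minus_bicomplex_def times_bicomplex_def scaleR_bicomplex_def bicomplex_eq_iff algebra_simps)

end

definition scale_bc :: "complex \<Rightarrow> bicomplex \<Rightarrow> bicomplex" where
  "scale_bc \<alpha> x = Bicomplex (\<alpha> * bc1 x) (\<alpha> * bc2 x)"

definition bc_i1 :: bicomplex where "bc_i1 = Bicomplex \<i> 0"

definition bc_i2 :: bicomplex where "bc_i2 = Bicomplex 0 1"

definition bc_e1 :: bicomplex where "bc_e1 = (1/2) *\<^sub>R (1 + bc_i1 * bc_i2)"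

definition bc_e2 :: bicomplex where "bc_e2 = (1/2) *\<^sub>R (1 - bc_i1 * bc_i2)"

definition idem_minus :: "bicomplex \<Rightarrow> complex" where
  "idem_minus x = bc1 x - \<i> * bc2 x"

definition idem_plus :: "bicomplex \<Rightarrow> complex" where
  "idem_plus x = bc1 x + \<i> * bc2 x"

lemmas bicomplex_defs =
  zero_bicomplex_def one_bicomplex_def plus_bicomplex_def uminus_bicomplex_def
  minus_bicomplex_def times_bicomplex_def scaleR_bicomplex_def scale_bc_def
  bc_i1_def bc_i2_def bc_e1_def bc_e2_def idem_minus_def idem_plus_def

lemma bc_i1_squared: "bc_i1 * bc_i1 = - 1"
  and bc_i2_squared: "bc_i2 * bc_i2 = - 1"
  by (simp_all add: bicomplex_defs)

lemma bicomplex_real_coordinates: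
  "Bicomplex (Complex a b) (Complex c d) =
     of_real a + bc_i1 * of_real b + bc_i2 * of_real c + bc_i1 * bc_i2 * of_real d"
  by (simp add: of_real_def bicomplex_defs bicomplex_eq_iff complex_eq_iff)

lemma scale_bc_eq_mult: "scale_bc \<alpha> x = Bicomplex \<alpha> 0 * x"
  by (simp add: bicomplex_defs)

lemma idempotent_representation:
  "x = scale_bc u bc_e1 + scale_bc v bc_e2 \<longleftrightarrow> u = idem_minus x \<and> v = idem_plus x"
proof -
  have "scale_bc u bc_e1 + scale_bc v bc_e2 = Bicomplex ((u + v) / 2) (\<i> * (u - v) / 2)"
    by (simp add: bicomplex_defs scaleR_conv_of_real field_simps)
  then show ?thesis
    by (auto simp: bicomplex_eq_iff idem_minus_def idem_plus_def complex_eq_iff field_simps)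
qed

definition f3 :: "bicomplex \<Rightarrow> bicomplex \<Rightarrow> complex" where
  "f3 x y = idem_minus x * cnj (idem_minus y) + idem_plus x * cnj (idem_plus y)"

end

theory Submission
  imports Defs
begin

text \<open>
  The idempotent components \<open>\<xi> \<mapsto> (\<xi>\<^sup>-, \<xi>\<^sup>+)\<close> identify the bicomplex numbers with \<open>\<complex>\<^sup>2\<close> as a
  complex vector space, and \<open>f3\<close> is the standard Hermitian inner product of \<open>\<complex>\<^sup>2\<close> pulled back along
  this map. Linearity of the map transfers additivity and homogeneity in the first argument, its
  injectivity transfers definiteness, and positivity is the formula
  \<open>f3 \<xi> \<xi> = |\<xi>\<^sup>-|\<^sup>2 + |\<xi>\<^sup>+|\<^sup>2\<close>.
\<close>

lemma idem_add:
  "idem_minus (x + y) = idem_minus x + idem_minus y"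
  "idem_plus (x + y) = idem_plus x + idem_plus y"
  by (simp_all add: bicomplex_defs algebra_simps)

lemma idem_scale_bc:
  "idem_minus (scale_bc \<alpha> x) = \<alpha> * idem_minus x"
  "idem_plus (scale_bc \<alpha> x) = \<alpha> * idem_plus x"
  by (simp_all add: bicomplex_defs algebra_simps)

text \<open>
  The coordinates are recovered from the components as half their sum and, up to a factor of
  \<open>2 * \<i>\<close>, their difference, so the kernel is trivial.
\<close>

lemma idem_eq_0_iff: "idem_minus x = 0 \<and> idem_plus x = 0 \<longleftrightarrow> x = 0"
proof
  assume "idem_minus x = 0 \<and> idem_plus x = 0"
  moreover have "2 * bc1 x = idem_plus x + idem_minus x"
    and "2 * \<i> * bc2 x = idem_plus x - idem_minus x"
    by (simp_all add: idem_minus_def idem_plus_def)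
  ultimately show "x = 0"
    by (simp add: bicomplex_eq_iff zero_bicomplex_def)
qed (simp add: bicomplex_defs)

lemma f3_self: "f3 x x = of_real ((cmod (idem_minus x))\<^sup>2 + (cmod (idem_plus x))\<^sup>2)"
  by (simp add: f3_def complex_norm_square del: of_real_power)

lemma f3_self_nonneg: "f3 x x \<in> \<real>\<^sub>\<ge>\<^sub>0"
  unfolding f3_self nonneg_Reals_of_real_iff by simp

lemma f3_self_eq_0_iff: "f3 x x = 0 \<longleftrightarrow> x = 0"
  unfolding f3_self of_real_eq_0_iff sum_power2_eq_zero_iff norm_eq_zero
  by (rule idem_eq_0_iff)

lemma cnj_f3: "cnj (f3 y x) = f3 x y"
  by (simp add: f3_def mult.commute)

lemma f3_add_left: "f3 (x + y) z = f3 x z + f3 y z"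
  by (simp add: f3_def idem_add algebra_simps)

lemma f3_scale_bc_left: "f3 (scale_bc \<alpha> x) y = \<alpha> * f3 x y"
  by (simp add: f3_def idem_scale_bc algebra_simps)

theorem theorem2p9:
  shows "(\<forall>\<xi>::bicomplex. f3 \<xi> \<xi> \<in> \<real>\<^sub>\<ge>\<^sub>0)
    \<and> (\<forall>\<xi>::bicomplex. f3 \<xi> \<xi> = 0 \<longleftrightarrow> \<xi> = 0)
    \<and> (\<forall>(\<xi>::bicomplex) (\<eta>::bicomplex). cnj (f3 \<eta> \<xi>) = f3 \<xi> \<eta>)
    \<and> (\<forall>(\<xi>::bicomplex) (\<eta>::bicomplex) (\<zeta>::bicomplex). f3 (\<xi> + \<eta>) \<zeta> = f3 \<xi> \<zeta> + f3 \<eta> \<zeta>)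
    \<and> (\<forall>(\<xi>::bicomplex) (\<eta>::bicomplex) (\<alpha>::complex). f3 (scale_bc \<alpha> \<xi>) \<eta> = \<alpha> * f3 \<xi> \<eta>)"
  by (simp add: f3_self_nonneg f3_self_eq_0_iff cnj_f3 f3_add_left f3_scale_bc_left)

end
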